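(* For every real $\lambda>0$ there is an algorithm for makespan scheduling with predictions on restricted-assignment machines under weighted fractional budget uncertainty that has consistency $1+1/\lambda$ and robustness $2+\lambda$. That is, for every instance (numbers of machines $m$ and jobs $n$, eligibility sets, intervals $[p_j^-,p_j^+]$, weights $w_j>0$ and budget $\Gamma\ge0$, defining the uncertainty set $\mathcal U$) and every predicted scenario $\hat q\in\mathcal U$, the algorithm returns a schedule $\mathcal S$ with $$C_{\max}(\mathcal S,\hat q)\le\Big(1+\frac1\lambda\Big)\mathrm{OPT}(\hat q)\quad\text{and}\quad \max_{q\in\mathcal U}C_{\max}(\mathcal S,q)\le(2+\lambda)\,\mathrm{OPT}^{\mathrm{rob}}(\mathcal U).$$
   Context: There are $m$ machines and $n$ jobs. A scenario is a matrix $q$ with entries $q_{i,j}\in[0,\infty]$. A schedule is a partition $\mathcal S=(S_1,\dots,S_m)$ of $[n]$ (parts may be empty), and $C_{\max}(\mathcal S,q)=\max_{i\in[m]}\sum_{j\in S_i}q_{i,j}$. $\mathrm{OPT}(q)=\min_{\mathcal S}C_{\max}(\mathcal S,q)$ and $\mathrm{OPT}^{\mathrm{rob}}(\mathcal U)=\min_{\mathcal S}\max_{q\in\mathcal U}C_{\max}(\mathcal S,q)$. Restricted assignment: each job $j$ has a size $p_j\ge0$ and an eligibility set $M_j\subseteq[m]$, and $q_{i,j}=p_j$ if $i\in M_j$, $q_{i,j}=\infty$ otherwise. Weighted fractional budget uncertainty: for given $0\le p_j^-\le p_j^+$, weights $w_j>0$ and $\Gamma\ge0$, $\mathcal U$ is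 the set of all scenarios obtained (with fixed eligibility sets) from size vectors $p$ with $p_j=p_j^-+z_j(p_j^+-p_j^-)$ for some $z\in[0,1]^n$ with $\sum_{j\in[n]}w_jz_j\le\Gamma$. An algorithm is a map from inputs to schedules; no computational restriction is imposed. *)

theory Defs
  imports "HOL-Analysis.Analysis"
begin

section \<open>Makespan scheduling on \<open>m\<close> machines and \<open>n\<close> jobs\<close>

text \<open>
  Machines are \<open>{1..m}\<close>, jobs are \<open>{1..n}\<close>. A scenario is a matrix with entries in
  \<open>[0, \<infinity>]\<close>; only the entries in \<open>{1..m} \<times> {1..n}\<close> matter.
\<close>

type_synonym scenario = "nat \<Rightarrow> nat \<Rightarrow> ennreal"
type_synonym schedule = "nat \<Rightarrow> nat set"

text \<open>
  Parts may be empty. Setting \<open>S i = {}\<close> outside \<open>{1..m}\<close> makes the representation of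
  \<open>(S\<^sub>1, \<dots>, S\<^sub>m)\<close> unique.
\<close>

definition schedules :: "nat \<Rightarrow> nat \<Rightarrow> schedule set" where
  "schedules m n = {S. (\<Union>i\<in>{1..m}. S i) = {1..n} \<and> disjoint_family_on S {1..m} \<and>
                       (\<forall>i. i \<notin> {1..m} \<longrightarrow> S i = {})}"

text \<open>
  Minima and maxima are written as infima and suprema in \<^typ>\<open>ennreal\<close>; the lemmas
  \<open>C_max_attained\<close>, \<open>OPT_attained\<close>, \<open>OPT_rob_attained\<close> and \<open>worst_case_attained\<close> below show
  that they are attained.
\<close>

definition C_max :: "nat \<Rightarrow> schedule \<Rightarrow> scenario \<Rightarrow> ennreal" where
  "C_max m S q = (SUP i\<in>{1..m}. \<Sum>j\<in>S i. q i j)"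

definition OPT :: "nat \<Rightarrow> nat \<Rightarrow> scenario \<Rightarrow> ennreal" where
  "OPT m n q = (INF S\<in>schedules m n. C_max m S q)"

definition OPT_rob :: "nat \<Rightarrow> nat \<Rightarrow> scenario set \<Rightarrow> ennreal" where
  "OPT_rob m n U = (INF S\<in>schedules m n. SUP q\<in>U. C_max m S q)"

section \<open>Restricted assignment under weighted fractional budget uncertainty\<close>

definition restricted_scenario :: "(nat \<Rightarrow> nat set) \<Rightarrow> (nat \<Rightarrow> real) \<Rightarrow> scenario" where
  "restricted_scenario M p = (\<lambda>i j. if i \<in> M j then ennreal (p j) else \<infinity>)"

record budget_instance =
  machines :: nat
  jobs :: nat
  elig :: "nat \<Rightarrow> nat set"
  p_lo :: "nat \<Rightarrow> real"
  p_hi :: "nat \<Rightarrow> real"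
  weight :: "nat \<Rightarrow> real"
  budget :: real

definition valid_instance :: "budget_instance \<Rightarrow> bool" where
  "valid_instance I \<longleftrightarrow>
     machines I \<ge> 1 \<and>
     (\<forall>j\<in>{1..jobs I}. elig I j \<subseteq> {1..machines I} \<and> 0 \<le> p_lo I j \<and> p_lo I j \<le> p_hi I j \<and>
        weight I j > 0) \<and>
     budget I \<ge> 0"

definition budget_vectors :: "budget_instance \<Rightarrow> (nat \<Rightarrow> real) set" where
  "budget_vectors I =
     {z \<in> {1..jobs I} \<rightarrow>\<^sub>E {0..1}. (\<Sum>j\<in>{1..jobs I}. weight I j * z j) \<le> budget I}"

definition uncertainty_set :: "budget_instance \<Rightarrow> scenario set" where
  "uncertainty_set I =
     (\<lambda>z. restricted_scenario (elig I) (\<lambda>j. p_lo I j + z j * (p_hi I j - p_lo I j)))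
       ` budget_vectors I"

section \<open>Attainment of the minima and maxima\<close>

lemma C_max_attained:
  assumes "m \<ge> 1"
  shows "\<exists>i\<in>{1..m}. C_max m S q = (\<Sum>j\<in>S i. q i j)"
proof -
  let ?A = "(\<lambda>i. \<Sum>j\<in>S i. q i j) ` {1..m}"
  have "?A \<noteq> {}" "finite ?A" using assms by auto
  then have "Sup ?A = Max ?A" "Max ?A \<in> ?A"
    by (simp_all add: cSup_eq_Max del: Max_in) (rule Max_in; simp)
  then show ?thesis by (auto simp: C_max_def)
qed

lemma finite_schedules: "finite (schedules m n)"
proof (rule finite_subset)
  show "schedules m n \<subseteq> {S. \<forall>i. (i \<in> {1..m} \<longrightarrow> S i \<in> Pow {1..n}) \<and> (i \<notin> {1..m} \<longrightarrow> S i = {})}"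
    unfolding schedules_def by blast
  show "finite {S::schedule. \<forall>i. (i \<in> {1..m} \<longrightarrow> S i \<in> Pow {1..n}) \<and> (i \<notin> {1..m} \<longrightarrow> S i = {})}"
    by (rule finite_set_of_finite_funs) auto
qed

lemma schedules_nonempty:
  assumes "m \<ge> 1"
  shows "schedules m n \<noteq> {}"
proof -
  have "(\<lambda>i. if i = 1 then {1..n} else {}) \<in> schedules m n"
    using assms by (auto simp: schedules_def disjoint_family_on_def split: if_splits)
  then show ?thesis by blast
qed

lemma INF_schedules_attained:
  fixes f :: "schedule \<Rightarrow> ennreal"
  assumes "m \<ge> 1"
  shows "\<exists>S\<in>schedules m n. (INF S\<in>schedules m n. f S) = f S"
proof -
  let ?A = "f ` schedules m n"
  have "?A \<noteq> {}" "finite ?A" using schedules_nonempty[OF assms] finite_schedules by auto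
  then have "Inf ?A = Min ?A" "Min ?A \<in> ?A"
    by (simp_all add: cInf_eq_Min del: Min_in) (rule Min_in; simp)
  then show ?thesis by auto
qed

lemma OPT_attained:
  assumes "m \<ge> 1"
  shows "\<exists>S\<in>schedules m n. OPT m n q = C_max m S q"
  using INF_schedules_attained[OF assms] unfolding OPT_def .

lemma OPT_rob_attained:
  assumes "m \<ge> 1"
  shows "\<exists>S\<in>schedules m n. OPT_rob m n U = (SUP q\<in>U. C_max m S q)"
  using INF_schedules_attained[OF assms] unfolding OPT_rob_def .

lemma compact_budget_vectors: "compact (budget_vectors I)"
proof -
  let ?K = "\<lambda>j. if j \<in> {1..jobs I} then {0..1::real} else {undefined}"
  have "compactin (product_topology (\<lambda>_. euclidean) UNIV) (Pi\<^sub>E UNIV ?K)"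
    by (subst compactin_PiE) auto
  then have c: "compact (Pi\<^sub>E UNIV ?K)"
    by (simp add: euclidean_product_topology)
  have "closed {z. (\<Sum>j\<in>{1..jobs I}. weight I j * z j) \<le> budget I}"
    by (intro closed_Collect_le continuous_intros
        continuous_on_subset[OF continuous_on_product_coordinates] subset_UNIV)
  moreover have "budget_vectors I =
      Pi\<^sub>E UNIV ?K \<inter> {z. (\<Sum>j\<in>{1..jobs I}. weight I j * z j) \<le> budget I}"
    by (auto simp: budget_vectors_def PiE_iff extensional_def split: if_splits)
  ultimately show ?thesis using c by (simp add: compact_Int_closed)
qed

lemma budget_vectors_nonempty:
  assumes "valid_instance I"
  shows "budget_vectors I \<noteq> {}"
proof -
  have "restrict (\<lambda>_. 0) {1..jobs I} \<in> budget_vectors I"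
    using assms by (auto simp: budget_vectors_def valid_instance_def)
  then show ?thesis by blast
qed

lemma continuous_load:
  fixes p :: "'a::topological_space \<Rightarrow> nat \<Rightarrow> real"
  assumes "finite T" "\<And>j. continuous_on Z (\<lambda>z. p z j)"
  shows "continuous_on Z (\<lambda>z. \<Sum>j\<in>T. restricted_scenario M (p z) i j)"
  using assms(1)
proof (induction T rule: finite_induct)
  case (insert j T)
  have "continuous_on Z (\<lambda>z. restricted_scenario M (p z) i j)"
    by (cases "i \<in> M j") (auto simp: restricted_scenario_def intro: continuous_on_ennreal assms(2))
  then show ?case using insert by (simp add: continuous_on_add_ennreal)
qed simp

lemma worst_case_attained:
  assumes I: "valid_instance I" and S: "S \<in> schedules (machines I) (jobs I)"
  shows "\<exists>q\<in>uncertainty_set I.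
           (SUP q\<in>uncertainty_set I. C_max (machines I) S q) = C_max (machines I) S q"
proof -
  define sc where "sc = (\<lambda>z. restricted_scenario (elig I)
    (\<lambda>j. p_lo I j + z j * (p_hi I j - p_lo I j)))"
  define load where "load = (\<lambda>i z. \<Sum>j\<in>S i. sc z i j)"
  let ?Z = "budget_vectors I"
  have m: "machines I \<ge> 1" using I by (simp add: valid_instance_def)
  have "\<exists>x\<in>?Z. \<forall>z\<in>?Z. load i z \<le> load i x" if i: "i \<in> {1..machines I}" for i
  proof (rule continuous_attains_sup[OF compact_budget_vectors budget_vectors_nonempty[OF I]])
    have "S i \<subseteq> {1..jobs I}" using S i unfolding schedules_def by blast
    then have "finite (S i)" using finite_subset by blast
    then show "continuous_on ?Z (load i)"
      unfolding load_def sc_def by (intro continuous_load continuous_intros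
        continuous_on_subset[OF continuous_on_product_coordinates] subset_UNIV)
  qed
  then obtain x where x: "\<And>i. i \<in> {1..machines I} \<Longrightarrow> x i \<in> ?Z"
    "\<And>i z. i \<in> {1..machines I} \<Longrightarrow> z \<in> ?Z \<Longrightarrow> load i z \<le> load i (x i)"
    by metis
  let ?A = "(\<lambda>i. load i (x i)) ` {1..machines I}"
  have "Max ?A \<in> ?A" using m by (intro Max_in) auto
  then obtain k where k: "k \<in> {1..machines I}" "Max ?A = load k (x k)" by auto
  have km: "load i (x i) \<le> load k (x k)" if "i \<in> {1..machines I}" for i
    using that unfolding k(2)[symmetric] by (intro Max_ge) auto
  have U: "uncertainty_set I = sc ` ?Z" by (simp add: uncertainty_set_def sc_def)
  have C: "C_max (machines I) S (sc z) = (SUP i\<in>{1..machines I}. load i z)" for z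
    by (simp add: C_max_def load_def)
  have ub: "C_max (machines I) S (sc z) \<le> load k (x k)" if "z \<in> ?Z" for z
    unfolding C by (rule SUP_least) (meson that x(2) km order_trans)
  have lb: "load k (x k) \<le> C_max (machines I) S (sc (x k))"
    unfolding C by (rule SUP_upper) (rule k(1))
  have mem: "sc (x k) \<in> uncertainty_set I" using x(1)[OF k(1)] U by blast
  have "(SUP q\<in>uncertainty_set I. C_max (machines I) S q) \<le> C_max (machines I) S (sc (x k))"
    by (rule SUP_least) (use U ub lb in \<open>force intro: order_trans\<close>)
  then show ?thesis using mem by (meson SUP_upper order_antisym)
qed

end

theory Submission
  imports Defs
begin

text \<open>
  Let \<open>A\<close> and \<open>B\<close> be the optimal values for the predicted scenario and for the robust problem.
  By linear programming duality for the fractional knapsack problem, a machine whose worst-case load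
  is at most \<open>B\<close> also has load at most \<open>B\<close> with respect to the deterministic sizes
  \<open>r\<^sub>j = p_lo\<^sub>j + max 0 (p_hi\<^sub>j - p_lo\<^sub>j - w\<^sub>j B / \<Gamma>)\<close>, and conversely the worst-case load of any set of jobs
  is at most its \<open>r\<close>-load plus \<open>B\<close>. Starting from a schedule that is optimal for the prediction and a
  robust optimal one, place job \<open>j\<close> with predicted size \<open>p\<^sub>j\<close> as in the former if
  \<open>r\<^sub>j / B \<le> \<lambda> p\<^sub>j / A\<close> and as in the latter otherwise. The jobs placed as in the robust optimal
  schedule add at most \<open>A / \<lambda>\<close> to the predicted load of a machine, and those placed as in the predicted
  optimal schedule add at most \<open>\<lambda> B\<close> to its \<open>r\<close>-load.
\<close>

section \<open>Real-valued loads and mixtures of schedules\<close>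

definition job_size :: "budget_instance \<Rightarrow> (nat \<Rightarrow> real) \<Rightarrow> nat \<Rightarrow> real" where
  "job_size I z j = p_lo I j + z j * (p_hi I j - p_lo I j)"

lemma uncertainty_set_eq:
  "uncertainty_set I = (\<lambda>z. restricted_scenario (elig I) (job_size I z)) ` budget_vectors I"
  by (simp add: uncertainty_set_def job_size_def[abs_def])

lemma job_size_nonneg:
  assumes "valid_instance I" "z \<in> budget_vectors I" "j \<in> {1..jobs I}"
  shows "0 \<le> job_size I z j"
  using assms by (auto simp: job_size_def valid_instance_def budget_vectors_def PiE_iff)

lemma schedule_subset:
  assumes "S \<in> schedules m n"
  shows "S i \<subseteq> {1..n}"
  using assms by (cases "i \<in> {1..m}") (auto simp: schedules_def)

lemma finite_schedule:
  assumes "S \<in> schedules m n"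
  shows "finite (S i)"
  using schedule_subset[OF assms] finite_subset by blast

text \<open>A single ineligible job makes the load of its machine infinite. A finite bound
  \<open>c\<close> therefore forces eligibility, and what remains is an inequality between
  reals.\<close>

lemma C_max_restricted_le_iff:
  assumes S: "S \<in> schedules m n" and p: "\<And>j. j \<in> {1..n} \<Longrightarrow> 0 \<le> p j" and c: "0 \<le> c"
  shows "C_max m S (restricted_scenario M p) \<le> ennreal c \<longleftrightarrow>
    (\<forall>i\<in>{1..m}. (\<forall>j\<in>S i. i \<in> M j) \<and> sum p (S i) \<le> c)"
proof -
  have "(\<Sum>j\<in>S i. restricted_scenario M p i j) \<le> ennreal c \<longleftrightarrow>
      (\<forall>j\<in>S i. i \<in> M j) \<and> sum p (S i) \<le> c" for i
  proof (cases "\<forall>j\<in>S i. i \<in> M j")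
    case True
    have "(\<Sum>j\<in>S i. restricted_scenario M p i j) = (\<Sum>j\<in>S i. ennreal (p j))"
      using True by (intro sum.cong) (auto simp: restricted_scenario_def)
    also have "\<dots> = ennreal (sum p (S i))"
      using schedule_subset[OF S] p by (intro sum_ennreal) blast
    finally show ?thesis using True c by (simp add: ennreal_le_iff)
  next
    case False
    then obtain j where j: "j \<in> S i" "i \<notin> M j" by blast
    have "restricted_scenario M p i j \<le> (\<Sum>j\<in>S i. restricted_scenario M p i j)"
      using finite_schedule[OF S] j(1) by (intro member_le_sum) auto
    then have "(\<Sum>j\<in>S i. restricted_scenario M p i j) = \<infinity>"
      using j(2) by (simp add: restricted_scenario_def top_unique)
    then show ?thesis using False by (simp add: top_unique)
  qed
  then show ?thesis by (simp add: C_max_def SUP_le_iff)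
qed

text \<open>Which schedule a job follows depends on the job alone, so it is still placed exactly
  once.\<close>

lemma mixed_schedule:
  assumes S: "S \<in> schedules m n" and T: "T \<in> schedules m n"
  shows "(\<lambda>i. {j \<in> S i. P j} \<union> {j \<in> T i. \<not> P j}) \<in> schedules m n" (is "?R \<in> _")
proof -
  have "(\<Union>i\<in>{1..m}. ?R i) = {1..n}"
  proof (intro equalityI subsetI)
    fix j assume "j \<in> {1..n}"
    then have "j \<in> (\<Union>i\<in>{1..m}. S i)" "j \<in> (\<Union>i\<in>{1..m}. T i)"
      using S T by (auto simp: schedules_def)
    then show "j \<in> (\<Union>i\<in>{1..m}. ?R i)" by (cases "P j") auto
  next
    fix j assume "j \<in> (\<Union>i\<in>{1..m}. ?R i)"
    then show "j \<in> {1..n}" using schedule_subset[OF S] schedule_subset[OF T] by blast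
  qed
  moreover have "disjoint_family_on ?R {1..m}"
    unfolding disjoint_family_on_def
  proof (intro ballI impI)
    fix i k assume ik: "i \<in> {1..m}" "k \<in> {1..m}" "i \<noteq> k"
    then have "S i \<inter> S k = {}" "T i \<inter> T k = {}"
      using S T by (auto simp: schedules_def disjoint_family_on_def)
    then show "?R i \<inter> ?R k = {}" by blast
  qed
  ultimately show ?thesis using S T by (simp add: schedules_def)
qed

section \<open>Deterministic sizes from knapsack duality\<close>

lemma budget_dual_sizes:
  assumes I: "valid_instance I" and B: "0 \<le> B"
  obtains r where "\<And>j. j \<in> {1..jobs I} \<Longrightarrow> 0 \<le> r j"
    and "\<And>T. T \<subseteq> {1..jobs I} \<Longrightarrow> (\<And>z. z \<in> budget_vectors I \<Longrightarrow> sum (job_size I z) T \<le> B) \<Longrightarrow>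
      sum r T \<le> B"
    and "\<And>T z. T \<subseteq> {1..jobs I} \<Longrightarrow> z \<in> budget_vectors I \<Longrightarrow> sum (job_size I z) T \<le> sum r T + B"
proof (cases "budget I = 0")
  \<comment> \<open>Here the price \<open>B / budget I\<close> is meaningless. Positive weights
    force every \<open>z\<close> to vanish, so all scenarios have sizes \<open>p_lo\<close> and
    these serve as \<open>r\<close>.\<close>
  case True
  have nn: "0 \<le> p_lo I j" "0 < weight I j" if "j \<in> {1..jobs I}" for j
    using I that by (auto simp: valid_instance_def)
  have z0: "z j = 0" if z: "z \<in> budget_vectors I" and j: "j \<in> {1..jobs I}" for z j
  proof -
    have zn: "\<And>j. j \<in> {1..jobs I} \<Longrightarrow> 0 \<le> z j" using z by (auto simp: budget_vectors_def PiE_iff)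
    have "weight I j * z j \<le> (\<Sum>j\<in>{1..jobs I}. weight I j * z j)"
    proof (rule member_le_sum[OF j])
      show "0 \<le> weight I k * z k" if "k \<in> {1..jobs I} - {j}" for k
        using zn[of k] nn(2)[of k] that by simp
    qed simp
    also have "\<dots> \<le> 0" using z True by (simp add: budget_vectors_def)
    finally show ?thesis using nn(2)[OF j] zn[OF j] by (simp add: mult_le_0_iff)
  qed
  then have eq: "sum (job_size I z) T = sum (p_lo I) T"
    if "z \<in> budget_vectors I" "T \<subseteq> {1..jobs I}" for z T
    using that by (intro sum.cong) (auto simp: job_size_def)
  obtain z where "z \<in> budget_vectors I" using budget_vectors_nonempty[OF I] by blast
  then show ?thesis
    using nn eq B by (intro that[of "p_lo I"]) auto
next
  case False
  \<comment> \<open>Dual price per unit of weight, chosen so that the whole budget costs exactly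
    \<open>B\<close>.\<close>
  define \<theta> where "\<theta> = B / budget I"
  define \<Delta> where "\<Delta> j = p_hi I j - p_lo I j" for j
  define r where "r j = p_lo I j + max 0 (\<Delta> j - weight I j * \<theta>)" for j
  have G: "0 < budget I" using I False by (simp add: valid_instance_def)
  have \<theta>: "0 \<le> \<theta>" "\<theta> * budget I = B" using B G by (auto simp: \<theta>_def)
  have nn: "0 \<le> p_lo I j" "0 < weight I j" "0 \<le> \<Delta> j" if "j \<in> {1..jobs I}" for j
    using I that by (auto simp: valid_instance_def \<Delta>_def)
  have size: "job_size I z j = p_lo I j + z j * \<Delta> j" for z j
    by (simp add: job_size_def \<Delta>_def)
  show ?thesis
  proof (rule that[of r])
    show "0 \<le> r j" if "j \<in> {1..jobs I}" for j using nn[OF that] by (simp add: r_def)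
  next
    fix T assume T: "T \<subseteq> {1..jobs I}"
      and le: "\<And>z. z \<in> budget_vectors I \<Longrightarrow> sum (job_size I z) T \<le> B"
    have fT: "finite T" using T finite_subset by blast
    \<comment> \<open>The jobs of \<open>T\<close> on which the positive part in \<open>r\<close> is
      active.\<close>
    define H where "H = {j \<in> T. weight I j * \<theta> < \<Delta> j}"
    have fH: "finite H" and HJ: "H \<subseteq> {1..jobs I}" using fT T by (auto simp: H_def)
    \<comment> \<open>Tests the hypothesis on the vector equal to \<open>c\<close> on
      \<open>H\<close> and 0 elsewhere. It is used with \<open>c = 1\<close> if all of
      \<open>H\<close> fits the budget, and with \<open>c = budget I / W\<close> otherwise.\<close>
    have step: "(\<Sum>j\<in>T. p_lo I j) + c * (\<Sum>j\<in>H. \<Delta> j) \<le> B"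
      if c: "0 \<le> c" "c \<le> 1" "c * (\<Sum>j\<in>H. weight I j) \<le> budget I" for c
    proof -
      define z where "z = (\<lambda>j\<in>{1..jobs I}. if j \<in> H then c else 0)"
      have "(\<Sum>j\<in>{1..jobs I}. weight I j * z j) = (\<Sum>j\<in>H. c * weight I j)"
        using HJ by (intro sum.mono_neutral_cong_right) (auto simp: z_def)
      then have "z \<in> budget_vectors I"
        using c by (auto simp: budget_vectors_def z_def sum_distrib_left)
      moreover have "(\<Sum>j\<in>T. z j * \<Delta> j) = (\<Sum>j\<in>H. c * \<Delta> j)"
        using HJ fT T by (intro sum.mono_neutral_cong_right) (auto simp: z_def H_def)
      ultimately show ?thesis
        using le[of z] by (simp add: size sum.distrib sum_distrib_left)
    qed
    have rT: "sum r T = (\<Sum>j\<in>T. p_lo I j) + (\<Sum>j\<in>H. \<Delta> j - weight I j * \<theta>)"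
    proof -
      have "(\<Sum>j\<in>T. max 0 (\<Delta> j - weight I j * \<theta>)) = (\<Sum>j\<in>H. \<Delta> j - weight I j * \<theta>)"
        using fT by (intro sum.mono_neutral_cong_right) (auto simp: H_def)
      then show ?thesis by (simp add: r_def sum.distrib)
    qed
    show "sum r T \<le> B"
    proof (cases "(\<Sum>j\<in>H. weight I j) \<le> budget I")
      case True
      have "(\<Sum>j\<in>H. \<Delta> j - weight I j * \<theta>) \<le> (\<Sum>j\<in>H. \<Delta> j)"
        using HJ nn(2) \<theta>(1) by (intro sum_mono) (auto simp: less_imp_le subset_iff)
      then show ?thesis using step[of 1] True rT by simp
    next
      \<comment> \<open>Spending the budget uniformly on \<open>H\<close> would give a load exceeding \<open>\<theta> * budget I = B\<close>.\<close>
      case False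
      define W where "W = (\<Sum>j\<in>H. weight I j)"
      have W: "budget I < W" "0 < W" using False G by (auto simp: W_def)
      have "H \<noteq> {}" using W by (auto simp: W_def)
      then have "(\<Sum>j\<in>H. weight I j * \<theta>) < (\<Sum>j\<in>H. \<Delta> j)"
        using fH by (intro sum_strict_mono) (auto simp: H_def)
      then have "budget I / W * (\<theta> * W) < budget I / W * (\<Sum>j\<in>H. \<Delta> j)"
        using G W by (intro mult_strict_left_mono) (auto simp: W_def sum_distrib_left mult.commute)
      moreover have "budget I / W * (\<theta> * W) = B" using W \<theta>(2) by (simp add: mult.commute)
      moreover have "0 \<le> (\<Sum>j\<in>T. p_lo I j)" using T nn(1) by (intro sum_nonneg) blast
      moreover have "(\<Sum>j\<in>T. p_lo I j) + budget I / W * (\<Sum>j\<in>H. \<Delta> j) \<le> B"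
        using G W by (intro step) (auto simp: W_def)
      ultimately show ?thesis by linarith
    qed
  next
    fix T z assume T: "T \<subseteq> {1..jobs I}" and z: "z \<in> budget_vectors I"
    have z01: "0 \<le> z j" "z j \<le> 1" if "j \<in> {1..jobs I}" for j
      using z that by (auto simp: budget_vectors_def PiE_iff)
    \<comment> \<open>Weak duality job by job: \<open>\<Delta> j\<close> is at most
      \<open>m + weight I j * \<theta>\<close>, and \<open>z j \<le> 1\<close> is applied to the
      \<open>m\<close> part only, so that the rest can be charged to the budget.\<close>
    have "job_size I z j \<le> r j + \<theta> * (weight I j * z j)" if "j \<in> T" for j
    proof -
      have j: "j \<in> {1..jobs I}" using that T by blast
      define m where "m = max 0 (\<Delta> j - weight I j * \<theta>)"
      have "z j * \<Delta> j \<le> z j * (m + weight I j * \<theta>)"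
        using z01[OF j] by (intro mult_left_mono) (auto simp: m_def)
      moreover have "z j * m \<le> 1 * m"
        using z01[OF j] by (intro mult_right_mono) (auto simp: m_def)
      moreover have "r j = p_lo I j + m" by (simp add: r_def m_def)
      ultimately show ?thesis by (simp add: size algebra_simps)
    qed
    then have "sum (job_size I z) T \<le> (\<Sum>j\<in>T. r j + \<theta> * (weight I j * z j))"
      by (rule sum_mono)
    also have "\<dots> = sum r T + \<theta> * (\<Sum>j\<in>T. weight I j * z j)"
      by (simp add: sum.distrib sum_distrib_left)
    also have "(\<Sum>j\<in>T. weight I j * z j) \<le> (\<Sum>j\<in>{1..jobs I}. weight I j * z j)"
    proof (rule sum_mono2[OF _ T])
      show "0 \<le> weight I j * z j" if "j \<in> {1..jobs I} - T" for j
        using nn(2)[of j] z01(1)[of j] that by simp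
    qed simp
    also have "\<dots> \<le> budget I" using z by (simp add: budget_vectors_def)
    finally show "sum (job_size I z) T \<le> sum r T + B" using \<theta> by (simp add: mult_left_mono)
  qed
qed

section \<open>Consistency and robustness of the mixture\<close>

lemma OPT_le_OPT_rob:
  assumes "q \<in> U"
  shows "OPT m n q \<le> OPT_rob m n U"
  unfolding OPT_def OPT_rob_def
  by (rule INF_mono) (use assms in \<open>auto intro: SUP_upper\<close>)

lemma consistent_robust_schedule:
  fixes lam :: real
  assumes lam: "lam > 0" and I: "valid_instance I" and q: "q \<in> uncertainty_set I"
  defines "m \<equiv> machines I" and "n \<equiv> jobs I"
  shows "\<exists>S\<in>schedules m n.
    C_max m S q \<le> ennreal (1 + 1 / lam) * OPT m n q \<and>
    (SUP q\<in>uncertainty_set I. C_max m S q)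
      \<le> ennreal (2 + lam) * OPT_rob m n (uncertainty_set I)"
proof -
  let ?U = "uncertainty_set I"
  have m: "m \<ge> 1" using I by (simp add: valid_instance_def m_def)
  have c1: "ennreal (1 + 1 / lam) \<ge> 1"
    using lam ennreal_leI[of 1 "1 + 1 / lam"] by simp
  have c2: "ennreal (2 + lam) \<noteq> 0" "ennreal (2 + lam) \<ge> 1"
    using lam ennreal_leI[of 1 "2 + lam"] by (auto simp del: ennreal_plus)
  have enl: "x \<le> c * x" if "1 \<le> c" for c x :: ennreal
    using mult_right_mono[OF that, of x] by simp
  obtain S where S: "S \<in> schedules m n" "OPT m n q = C_max m S q"
    using OPT_attained[OF m] by blast
  obtain T where T: "T \<in> schedules m n" "OPT_rob m n ?U = (SUP q\<in>?U. C_max m T q)"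
    using OPT_rob_attained[OF m] by blast
  show ?thesis
  proof (cases "OPT_rob m n ?U = top")
    case True
    \<comment> \<open>The robust bound is infinite, since its factor is nonzero, so \<open>S\<close>
      itself suffices.\<close>
    then show ?thesis using S enl[OF c1] c2(1) by (auto simp: ennreal_mult_top)
  next
    case False
    then obtain B where B: "OPT_rob m n ?U = ennreal B" "0 \<le> B"
      by (cases "OPT_rob m n ?U") auto
    have AB': "OPT m n q \<le> ennreal B" using OPT_le_OPT_rob[OF q] B(1) by metis
    then obtain A where A: "OPT m n q = ennreal A" "0 \<le> A"
      by (cases "OPT m n q") (auto simp: top_unique)
    have AB: "A \<le> B" using AB' A B by (simp add: ennreal_le_iff)
    obtain z where z: "z \<in> budget_vectors I" "q = restricted_scenario (elig I) (job_size I z)"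
      using q by (auto simp: uncertainty_set_eq)
    let ?p = "job_size I z"
    have pn: "\<And>z j. z \<in> budget_vectors I \<Longrightarrow> j \<in> {1..n} \<Longrightarrow> 0 \<le> job_size I z j"
      unfolding n_def by (rule job_size_nonneg[OF I])
    have cmx: "C_max m R (restricted_scenario (elig I) (job_size I y)) \<le> ennreal c \<longleftrightarrow>
        (\<forall>i\<in>{1..m}. (\<forall>j\<in>R i. i \<in> elig I j) \<and> sum (job_size I y) (R i) \<le> c)"
      if "R \<in> schedules m n" "y \<in> budget_vectors I" "0 \<le> c" for R y c
      using C_max_restricted_le_iff[OF that(1) pn[OF that(2)] that(3)] by simp
    have Sload: "\<forall>i\<in>{1..m}. (\<forall>j\<in>S i. i \<in> elig I j) \<and> sum ?p (S i) \<le> A"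
      using cmx[OF S(1) z(1) A(2)] S(2) A(1) z(2) by simp
    have Tload: "\<forall>i\<in>{1..m}. (\<forall>j\<in>T i. i \<in> elig I j) \<and> sum (job_size I y) (T i) \<le> B"
      if y: "y \<in> budget_vectors I" for y
    proof -
      have "C_max m T (restricted_scenario (elig I) (job_size I y)) \<le> ennreal B"
        unfolding B(1)[symmetric] T(2)
        by (rule SUP_upper) (use y in \<open>auto simp: uncertainty_set_eq\<close>)
      then show ?thesis using cmx[OF T(1) y B(2)] by simp
    qed
    show ?thesis
    \<comment> \<open>The ratio test needs \<open>A > 0\<close>. If \<open>A = 0\<close>, every job
      has predicted size 0, so the robust optimal \<open>T\<close> is also optimal for the
      prediction.\<close>
    proof (cases "A = 0")
      case True
      have "?p j = 0" if j: "j \<in> {1..n}" for j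
      proof -
        obtain i where i: "i \<in> {1..m}" "j \<in> S i" using S(1) j unfolding schedules_def by blast
        have "?p j \<le> sum ?p (S i)"
          using i(2) finite_schedule[OF S(1)] schedule_subset[OF S(1), of i] pn[OF z(1)]
          by (intro member_le_sum) blast+
        then show ?thesis using Sload i(1) pn[OF z(1) j] True by fastforce
      qed
      then have "sum ?p (T i) = 0" for i
        using schedule_subset[OF T(1)] by (intro sum.neutral) blast
      then have "C_max m T q \<le> ennreal 0"
        using Tload[OF z(1)] cmx[OF T(1) z(1), of 0] by (simp add: z(2))
      then show ?thesis using T enl[OF c2(2)] by (intro bexI[of _ T]) auto
    next
      case False
      then have pos: "0 < A" "0 < B" using A(2) AB by auto
      obtain r where r: "\<And>j. j \<in> {1..n} \<Longrightarrow> 0 \<le> r j"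
        "\<And>T. T \<subseteq> {1..n} \<Longrightarrow> (\<And>y. y \<in> budget_vectors I \<Longrightarrow> sum (job_size I y) T \<le> B) \<Longrightarrow>
           sum r T \<le> B"
        "\<And>T y. T \<subseteq> {1..n} \<Longrightarrow> y \<in> budget_vectors I \<Longrightarrow> sum (job_size I y) T \<le> sum r T + B"
        using budget_dual_sizes[OF I B(2)] unfolding n_def by metis
      \<comment> \<open>Cross-multiplied form of \<open>r j / B \<le> lam * ?p j / A\<close>, which
        sums without division.\<close>
      define P where "P j \<longleftrightarrow> r j * A \<le> lam * ?p j * B" for j
      define R where "R = (\<lambda>i. {j \<in> S i. P j} \<union> {j \<in> T i. \<not> P j})"
      have R: "R \<in> schedules m n" unfolding R_def by (rule mixed_schedule[OF S(1) T(1)])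
      have eligR: "\<forall>j\<in>R i. i \<in> elig I j" if "i \<in> {1..m}" for i
        using that Sload Tload[OF z(1)] by (auto simp: R_def)
      have split: "sum f (R i) = sum f {j \<in> S i. P j} + sum f {j \<in> T i. \<not> P j}"
        for f :: "nat \<Rightarrow> real" and i
        unfolding R_def using finite_schedule[OF S(1)] finite_schedule[OF T(1)]
        by (intro sum.union_disjoint) auto
      have part: "sum f {j \<in> X i. Q j} \<le> sum f (X i)"
        if "X \<in> schedules m n" "\<And>j. j \<in> {1..n} \<Longrightarrow> 0 \<le> f j" for X Q i and f :: "nat \<Rightarrow> real"
        using finite_schedule[OF that(1)] schedule_subset[OF that(1)] that(2)
        by (intro sum_mono2) blast+
      have pS: "sum ?p {j \<in> S i. P j} \<le> A" if "i \<in> {1..m}" for i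
        using part[where f = ?p and Q = P, OF S(1) pn[OF z(1)]] Sload that
        by (meson order_trans)
      have rT: "sum r {j \<in> T i. \<not> P j} \<le> B" if "i \<in> {1..m}" for i
      proof -
        have "sum r {j \<in> T i. \<not> P j} \<le> sum r (T i)"
          by (rule part[OF T(1) r(1)])
        also have "\<dots> \<le> B"
          using r(2)[OF schedule_subset[OF T(1)]] Tload that by blast
        finally show ?thesis .
      qed
      have pR: "sum ?p (R i) \<le> (1 + 1 / lam) * A" if i: "i \<in> {1..m}" for i
      proof -
        \<comment> \<open>Sum the failed test over the jobs taken from \<open>T\<close>; their
          \<open>r\<close>-load is at most \<open>B\<close>, and cancelling \<open>lam * B\<close>
          leaves \<open>A / lam\<close>.\<close>
        have "lam * B * sum ?p {j \<in> T i. \<not> P j} \<le> A * sum r {j \<in> T i. \<not> P j}"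
          unfolding sum_distrib_left by (rule sum_mono) (auto simp: P_def algebra_simps)
        also have "\<dots> \<le> A * B"
          using rT[OF i] pos(1) by (intro mult_left_mono) auto
        finally have "B * (lam * sum ?p {j \<in> T i. \<not> P j}) \<le> B * A" by (simp add: algebra_simps)
        then have "sum ?p {j \<in> T i. \<not> P j} \<le> A / lam"
          using pos(2) lam by (simp add: field_simps)
        then show ?thesis using pS[OF i] by (simp add: split algebra_simps)
      qed
      have rR: "sum r (R i) \<le> (1 + lam) * B" if i: "i \<in> {1..m}" for i
      proof -
        \<comment> \<open>The symmetric exchange: the test holds on the jobs taken from
          \<open>S\<close>, whose predicted load is at most \<open>A\<close>.\<close>
        have "A * sum r {j \<in> S i. P j} \<le> lam * B * sum ?p {j \<in> S i. P j}"
          unfolding sum_distrib_left by (rule sum_mono) (auto simp: P_def algebra_simps)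
        also have "\<dots> \<le> lam * B * A"
          using pS[OF i] pos(2) lam by (intro mult_left_mono) auto
        finally have "sum r {j \<in> S i. P j} \<le> lam * B"
          using pos(1) by (simp add: mult.commute)
        then show ?thesis using rT[OF i] by (simp add: split algebra_simps)
      qed
      have "C_max m R q \<le> ennreal ((1 + 1 / lam) * A)"
        unfolding z(2) using cmx[OF R z(1)] eligR pR lam A(2) by simp
      moreover have "C_max m R q' \<le> ennreal ((2 + lam) * B)" if q': "q' \<in> ?U" for q'
      proof -
        obtain y where y: "y \<in> budget_vectors I"
          "q' = restricted_scenario (elig I) (job_size I y)"
          using q' by (auto simp: uncertainty_set_eq)
        \<comment> \<open>Passing from the \<open>r\<close>-load back to an arbitrary scenario costs
          one more \<open>B\<close>, which turns \<open>1 + lam\<close> into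
          \<open>2 + lam\<close>.\<close>
        have "sum (job_size I y) (R i) \<le> (2 + lam) * B" if "i \<in> {1..m}" for i
          using r(3)[OF schedule_subset[OF R] y(1), of i] rR[OF that] by (simp add: algebra_simps)
        then show ?thesis unfolding y(2) using cmx[OF R y(1)] eligR lam B(2) by simp
      qed
      then have "(SUP q\<in>?U. C_max m R q) \<le> ennreal ((2 + lam) * B)" by (rule SUP_least)
      ultimately show ?thesis using R lam A B by (auto simp: ennreal_mult)
    qed
  qed
qed

theorem theorem16:
  fixes lam :: real
  assumes "lam > 0"
  shows "\<exists>Alg :: budget_instance \<Rightarrow> scenario \<Rightarrow> schedule.
    \<forall>I. valid_instance I \<longrightarrow> (\<forall>q_hat\<in>uncertainty_set I.
      Alg I q_hat \<in> schedules (machines I) (jobs I) \<and>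
      C_max (machines I) (Alg I q_hat) q_hat
        \<le> ennreal (1 + 1 / lam) * OPT (machines I) (jobs I) q_hat \<and>
      (SUP q\<in>uncertainty_set I. C_max (machines I) (Alg I q_hat) q)
        \<le> ennreal (2 + lam) * OPT_rob (machines I) (jobs I) (uncertainty_set I))"
proof -
  \<comment> \<open>With validity moved under the existential, choice yields a total function whose
    output on invalid inputs is arbitrary.\<close>
  have "\<forall>I q_hat. \<exists>S. valid_instance I \<and> q_hat \<in> uncertainty_set I \<longrightarrow>
      S \<in> schedules (machines I) (jobs I) \<and>
      C_max (machines I) S q_hat \<le> ennreal (1 + 1 / lam) * OPT (machines I) (jobs I) q_hat \<and>
      (SUP q\<in>uncertainty_set I. C_max (machines I) S q)
        \<le> ennreal (2 + lam) * OPT_rob (machines I) (jobs I) (uncertainty_set I)"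
    using consistent_robust_schedule[OF assms] by blast
  then show ?thesis unfolding choice_iff by blast
qed

end
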